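(* Let $(X,d_X)$ be a metric space that admits a surjective uniform expansion, i.e., for some $\lambda>1$ there is a surjective map $T:X\to X$ with $d_X(T(x),T(y))=\lambda\,d_X(x,y)$ for all $x,y\in X$. If $X$ has weak finite decomposition complexity, then $X$ has finite asymptotic dimension.
   Context: A metric family is a (countable) collection of metric spaces; a single metric space $X$ is viewed as the metric family $\{X\}$. Decomposition: Let $r>0$ and let $n$ be a non-negative integer. A metric family $\mathcal{X}$ is $(r,n)$-decomposable over a metric family $\mathcal{Y}$ if every $X\in\mathcal{X}$ can be written as $X=X_0\cup X_1\cup\cdots\cup X_n$ such that each $X_i$ is an $r$-disjoint union $X_i=\bigsqcup_j X_{ij}$ with each $X_{ij}$ in $\mathcal{Y}$ (subsets carry the subspace metric). Here $r$-disjoint means $d(U,V)>r$ for any two distinct members $U\neq V$ of the union. If $\mathfrak{C}$ is a collection of metric families, $\mathcal{X}$ is $n$-decomposable over $\mathfrak{C}$ if for every $r>0$ it is $(r,n)$-decomposable over some metric family $\mathcal{Y}$ in $\mathfrak{C}$. It is weakly decomposable over $\mathfrak{C}$ if it is $n$-decomposable over $\mathfrak{C}$ for some non-negative integer $n$. A collection $\mathfrak{C}$ is closed under weak decomposition if every metric family that is weakly decomposable over $\mathfrak{C}$ belongs to $\mathfrak{C}$. A metric family $\mathcal{Z}$ is bounded if $\sup\{\operatorname{diam}(Z)\mid Z\in\mathcal{Z}\}<\infty$; $\mathfrak{B}$ denotes the collection of all bounded metric families. Let $w\mathfrak{D}$ be the smallest collection of metric families containing $\mathfrak{B}$ that is closed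 under weak decomposition. A metric family in $w\mathfrak{D}$ has weak finite decomposition complexity. Asymptotic dimension: for a non-negative integer $n$, $\operatorname{asdim}X\le n$ if for every $r>0$ there is a cover $\mathcal{U}=\mathcal{U}_0\cup\cdots\cup\mathcal{U}_n$ of $X$ such that each $\mathcal{U}_i$ is $r$-disjoint ($d(U,V)>r$ for every $U\ne V$ in $\mathcal{U}_i$) and $\sup\{\operatorname{diam}(U)\mid U\in\mathcal{U}\}<\infty$; equivalently, $\{X\}$ is $n$-decomposable over $\mathfrak{B}$. $X$ has finite asymptotic dimension if such an $n$ exists. *)

theory Defs
  imports "HOL-Analysis.Analysis"
begin

text \<open>Distances between sets and diameters take values in \<^typ>\<open>ennreal\<close>, so that
  \<open>d(U, {}) = \<infinity>\<close>, \<open>diam {} = 0\<close>, and unbounded sets have diameter \<open>\<infinity>\<close>.\<close>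

definition mset_dist :: "'a metric \<Rightarrow> 'a set \<Rightarrow> 'a set \<Rightarrow> ennreal" where
  "mset_dist X U V = (INF x\<in>U. INF y\<in>V. ennreal (mdist X x y))"

definition mdiam :: "'a metric \<Rightarrow> 'a set \<Rightarrow> ennreal" where
  "mdiam X U = (SUP x\<in>U. SUP y\<in>U. ennreal (mdist X x y))"

definition r_disjoint :: "'a metric \<Rightarrow> real \<Rightarrow> 'a set set \<Rightarrow> bool" where
  "r_disjoint X r \<U> \<longleftrightarrow> (\<forall>U\<in>\<U>. \<forall>V\<in>\<U>. U \<noteq> V \<longrightarrow> mset_dist X U V > ennreal r)"

text \<open>A metric family consists of metric spaces whose points are taken from a fixed but arbitrary
  type. This universe suffices because decomposing a space only produces subspaces of it.\<close>

definition metric_family :: "'a metric set \<Rightarrow> bool" where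
  "metric_family \<X> \<longleftrightarrow> countable \<X>"

definition r_disjoint_union_in :: "'a metric \<Rightarrow> real \<Rightarrow> 'a metric set \<Rightarrow> 'a set \<Rightarrow> bool" where
  "r_disjoint_union_in X r \<Y> A \<longleftrightarrow>
     (\<exists>\<U>. A = \<Union>\<U> \<and> r_disjoint X r \<U> \<and> (\<forall>U\<in>\<U>. submetric X U \<in> \<Y>))"

definition decomposable_over :: "real \<Rightarrow> nat \<Rightarrow> 'a metric set \<Rightarrow> 'a metric set \<Rightarrow> bool" where
  "decomposable_over r n \<X> \<Y> \<longleftrightarrow>
     (\<forall>X\<in>\<X>. \<exists>A :: nat \<Rightarrow> 'a set.
        mspace X = (\<Union>i\<le>n. A i) \<and> (\<forall>i\<le>n. r_disjoint_union_in X r \<Y> (A i)))"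

definition n_decomposable_over :: "nat \<Rightarrow> 'a metric set \<Rightarrow> 'a metric set set \<Rightarrow> bool" where
  "n_decomposable_over n \<X> \<CC> \<longleftrightarrow> (\<forall>r>0. \<exists>\<Y>\<in>\<CC>. decomposable_over r n \<X> \<Y>)"

definition weakly_decomposable_over :: "'a metric set \<Rightarrow> 'a metric set set \<Rightarrow> bool" where
  "weakly_decomposable_over \<X> \<CC> \<longleftrightarrow> (\<exists>n. n_decomposable_over n \<X> \<CC>)"

definition closed_under_weak_decomposition :: "'a metric set set \<Rightarrow> bool" where
  "closed_under_weak_decomposition \<CC> \<longleftrightarrow>
     (\<forall>\<X>. metric_family \<X> \<and> weakly_decomposable_over \<X> \<CC> \<longrightarrow> \<X> \<in> \<CC>)"

definition bounded_families :: "'a metric set set" where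
  "bounded_families = {\<Z>. metric_family \<Z> \<and> (SUP Z\<in>\<Z>. mdiam Z (mspace Z)) < \<infinity>}"

text \<open>The smallest collection is defined as an intersection; the lemmas below show that this
  intersection is itself one of the collections concerned.\<close>

definition wD :: "'a metric set set" where
  "wD = \<Inter>{\<CC>. \<CC> \<subseteq> Collect metric_family \<and> bounded_families \<subseteq> \<CC> \<and>
               closed_under_weak_decomposition \<CC>}"

lemma weakly_decomposable_over_mono:
  "weakly_decomposable_over \<X> \<CC> \<Longrightarrow> \<CC> \<subseteq> \<CC>' \<Longrightarrow> weakly_decomposable_over \<X> \<CC>'"
  unfolding weakly_decomposable_over_def n_decomposable_over_def by blast

lemma wD_metric_family: "wD \<subseteq> Collect metric_family"
  unfolding wD_def
  by (rule Inter_lower) (auto simp: bounded_families_def closed_under_weak_decomposition_def)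

lemma bounded_families_subset_wD: "bounded_families \<subseteq> wD"
  unfolding wD_def by blast

lemma wD_least:
  assumes "\<CC> \<subseteq> Collect metric_family" "bounded_families \<subseteq> \<CC>"
    and "closed_under_weak_decomposition \<CC>"
  shows "wD \<subseteq> \<CC>"
  unfolding wD_def using assms by blast

lemma closed_wD: "closed_under_weak_decomposition wD"
  unfolding closed_under_weak_decomposition_def
proof (intro allI impI)
  fix \<X> :: "'a metric set"
  assume \<X>: "metric_family \<X> \<and> weakly_decomposable_over \<X> wD"
  have "\<X> \<in> \<CC>" if "\<CC> \<subseteq> Collect metric_family" "bounded_families \<subseteq> \<CC>"
    and "closed_under_weak_decomposition \<CC>" for \<CC>
    using \<X> weakly_decomposable_over_mono[OF _ wD_least[OF that]] that(3)
    unfolding closed_under_weak_decomposition_def by blast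
  then show "\<X> \<in> wD"
    unfolding wD_def by blast
qed

definition weak_fdc :: "'a metric set \<Rightarrow> bool" where
  "weak_fdc \<X> \<longleftrightarrow> \<X> \<in> wD"

definition asdim_le :: "'a metric \<Rightarrow> nat \<Rightarrow> bool" where
  "asdim_le X n \<longleftrightarrow>
     (\<forall>r>0. \<exists>\<U> :: nat \<Rightarrow> 'a set set.
        (\<Union>i\<le>n. \<Union>(\<U> i)) = mspace X \<and>
        (\<forall>i\<le>n. r_disjoint X r (\<U> i)) \<and>
        (SUP U\<in>(\<Union>i\<le>n. \<U> i). mdiam X U) < \<infinity>)"

definition finite_asdim :: "'a metric \<Rightarrow> bool" where
  "finite_asdim X \<longleftrightarrow> (\<exists>n. asdim_le X n)"

definition uniform_expansion :: "'a metric \<Rightarrow> real \<Rightarrow> ('a \<Rightarrow> 'a) \<Rightarrow> bool" where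
  "uniform_expansion X c T \<longleftrightarrow>
     T \<in> mspace X \<rightarrow> mspace X \<and>
     (\<forall>x\<in>mspace X. \<forall>y\<in>mspace X. mdist X (T x) (T y) = c * mdist X x y)"

end

theory Submission
  imports Defs
begin

text \<open>Weak finite decomposition complexity provides, at any one scale \<open>r\<close>, a decomposition over a
  bounded family with finitely many colours.  Indeed, performing an \<open>(r, n)\<close>-decomposition and then
  an \<open>(r, m)\<close>-decomposition of all the pieces, at the same scale \<open>r\<close>, is a decomposition at scale
  \<open>r\<close> whose \<open>(n + 1) * (m + 1)\<close> colours are the pairs of old ones
  (\<open>decomposable_over_trans\<close>).  Hence the families that are decomposable at scale \<open>r\<close> over some
  bounded family form a collection closed under weak decomposition, and minimality of \<^const>\<open>wD\<close>
  applies (\<open>wD_decomposable_over_bounded\<close>).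

  In general the number of colours obtained this way may grow with \<open>r\<close>, and this is the gap between
  weak finite decomposition complexity and finite asymptotic dimension.  A surjective
  expansion closes it: a power of the expansion carries the cover found at scale 1
  to a cover of the whole space at any prescribed larger scale, with the same
  number of colours and with diameters still uniformly bounded (\<open>asdim_le_if_expansion\<close>).\<close>

section \<open>Distances and diameters in subspaces\<close>

lemma mset_dist_submetric [simp]: "mset_dist (submetric X S) U V = mset_dist X U V"
  by (simp add: mset_dist_def)

lemma r_disjoint_submetric [simp]: "r_disjoint (submetric X S) r \<U> = r_disjoint X r \<U>"
  by (simp add: r_disjoint_def)

lemma mdiam_submetric [simp]: "mdiam (submetric X S) U = mdiam X U"
  by (simp add: mdiam_def)

lemma mset_dist_antimono: "U' \<subseteq> U \<Longrightarrow> V' \<subseteq> V \<Longrightarrow> mset_dist X U V \<le> mset_dist X U' V'"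
  unfolding mset_dist_def by (intro INF_mono) (meson INF_superset_mono order_refl subsetD)

lemma mset_dist_le: "x \<in> U \<Longrightarrow> y \<in> V \<Longrightarrow> mset_dist X U V \<le> ennreal (mdist X x y)"
  unfolding mset_dist_def by (meson INF_lower2 order_refl)

lemma le_mdiam: "x \<in> U \<Longrightarrow> y \<in> U \<Longrightarrow> ennreal (mdist X x y) \<le> mdiam X U"
  unfolding mdiam_def by (meson SUP_upper2 order_refl)

section \<open>Iterated decompositions at a fixed scale\<close>

text \<open>Subpieces of different pieces are at least as far apart as the pieces themselves.\<close>

lemma r_disjoint_UN:
  assumes \<U>: "r_disjoint X r \<U>"
    and \<V>: "\<And>U. U \<in> \<U> \<Longrightarrow> r_disjoint X r (\<V> U)"
    and sub: "\<And>U. U \<in> \<U> \<Longrightarrow> \<Union>(\<V> U) \<subseteq> U"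
  shows "r_disjoint X r (\<Union>U\<in>\<U>. \<V> U)"
  unfolding r_disjoint_def
proof (intro ballI impI)
  fix V V'
  assume "V \<in> (\<Union>U\<in>\<U>. \<V> U)" "V' \<in> (\<Union>U\<in>\<U>. \<V> U)" and ne: "V \<noteq> V'"
  then obtain U U' where U: "U \<in> \<U>" "V \<in> \<V> U" and U': "U' \<in> \<U>" "V' \<in> \<V> U'"
    by blast
  show "mset_dist X V V' > ennreal r"
  proof (cases "U = U'")
    case True
    with \<V>[OF U(1)] U U' ne show ?thesis
      by (simp add: r_disjoint_def)
  next
    case False
    with \<U> U U' have "mset_dist X U U' > ennreal r"
      by (simp add: r_disjoint_def)
    also have "mset_dist X U U' \<le> mset_dist X V V'"
      using sub U U' by (intro mset_dist_antimono) blast+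
    finally show ?thesis .
  qed
qed

lemma decomposable_over_trans:
  assumes XY: "decomposable_over r n \<X> \<Y>" and YZ: "decomposable_over r m \<Y> \<Z>"
  shows "decomposable_over r (Suc n * Suc m - 1) \<X> \<Z>"
  unfolding decomposable_over_def
proof
  fix X assume "X \<in> \<X>"
  then obtain A where A: "mspace X = (\<Union>i\<le>n. A i)"
    and "\<forall>i\<le>n. r_disjoint_union_in X r \<Y> (A i)"
    using XY unfolding decomposable_over_def by blast
  then obtain \<U> where \<U>: "\<And>i. i \<le> n \<Longrightarrow> A i = \<Union>(\<U> i)"
      "\<And>i. i \<le> n \<Longrightarrow> r_disjoint X r (\<U> i)"
      "\<And>i U. i \<le> n \<Longrightarrow> U \<in> \<U> i \<Longrightarrow> submetric X U \<in> \<Y>"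
    unfolding r_disjoint_union_in_def by metis
  have sub: "U \<subseteq> mspace X" if "i \<le> n" "U \<in> \<U> i" for i U
    using that A \<U>(1) by blast
  have "\<exists>\<V>. U = (\<Union>j\<le>m. \<Union>(\<V> j)) \<and>
      (\<forall>j\<le>m. r_disjoint X r (\<V> j) \<and> (\<forall>V\<in>\<V> j. submetric X V \<in> \<Z>))"
    if U: "U \<in> (\<Union>i\<le>n. \<U> i)" for U
  proof -
    have UX: "U \<subseteq> mspace X" and "submetric X U \<in> \<Y>"
      using U sub \<U>(3) by blast+
    then obtain B where B: "U = (\<Union>j\<le>m. B j)"
      and "\<forall>j\<le>m. r_disjoint_union_in (submetric X U) r \<Z> (B j)"
      using YZ unfolding decomposable_over_def by (metis Int_absorb2 mspace_submetric)
    then obtain \<V> where \<V>: "\<And>j. j \<le> m \<Longrightarrow> B j = \<Union>(\<V> j)"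
      "\<And>j. j \<le> m \<Longrightarrow> r_disjoint X r (\<V> j)"
      "\<And>j V. j \<le> m \<Longrightarrow> V \<in> \<V> j \<Longrightarrow> submetric (submetric X U) V \<in> \<Z>"
      unfolding r_disjoint_union_in_def r_disjoint_submetric by metis
    have "submetric X V \<in> \<Z>" if "j \<le> m" "V \<in> \<V> j" for j V
    proof -
      have "V \<subseteq> U" using that B \<V>(1) by blast
      then show ?thesis
        using \<V>(3)[OF that] by (simp add: Int_absorb1)
    qed
    moreover have "U = (\<Union>j\<le>m. \<Union>(\<V> j))"
      using B \<V>(1) by simp
    ultimately show ?thesis
      using \<V>(2) by blast
  qed
  then obtain \<V> where \<V>: "\<And>U. U \<in> (\<Union>i\<le>n. \<U> i) \<Longrightarrow> U = (\<Union>j\<le>m. \<Union>(\<V> U j))"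
      "\<And>U j. U \<in> (\<Union>i\<le>n. \<U> i) \<Longrightarrow> j \<le> m \<Longrightarrow> r_disjoint X r (\<V> U j)"
      "\<And>U j V. U \<in> (\<Union>i\<le>n. \<U> i) \<Longrightarrow> j \<le> m \<Longrightarrow> V \<in> \<V> U j \<Longrightarrow> submetric X V \<in> \<Z>"
    by metis
  \<comment> \<open>The pair of colours \<open>(i, j)\<close> is encoded as \<open>i * Suc m + j\<close>.\<close>
  define \<W> where "\<W> k = (\<Union>U\<in>\<U> (k div Suc m). \<V> U (k mod Suc m))" for k
  have div: "k div Suc m \<le> n" if "k \<le> Suc n * Suc m - 1" for k
  proof -
    have "k < Suc n * Suc m" using that by simp
    then show ?thesis by (metis less_Suc_eq_le less_mult_imp_div_less)
  qed
  have mod: "k mod Suc m \<le> m" for k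
    using mod_less_divisor[of "Suc m" k] by simp
  have "r_disjoint_union_in X r \<Z> (\<Union>(\<W> k))" if k: "k \<le> Suc n * Suc m - 1" for k
    unfolding r_disjoint_union_in_def
  proof (intro exI conjI ballI)
    show "r_disjoint X r (\<W> k)"
      unfolding \<W>_def
    proof (rule r_disjoint_UN[OF \<U>(2)[OF div[OF k]]])
      fix U assume "U \<in> \<U> (k div Suc m)"
      then have U: "U \<in> (\<Union>i\<le>n. \<U> i)" using div[OF k] by blast
      show "r_disjoint X r (\<V> U (k mod Suc m))"
        using \<V>(2)[OF U mod] .
      show "\<Union>(\<V> U (k mod Suc m)) \<subseteq> U"
        using \<V>(1)[OF U] mod by blast
    qed
    show "submetric X V \<in> \<Z>" if "V \<in> \<W> k" for V
      using that div[OF k] \<V>(3)[OF _ mod] unfolding \<W>_def by blast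
  qed simp
  moreover have "mspace X = (\<Union>k\<le>Suc n * Suc m - 1. \<Union>(\<W> k))"
  proof
    show "mspace X \<subseteq> (\<Union>k\<le>Suc n * Suc m - 1. \<Union>(\<W> k))"
    proof
      fix x assume "x \<in> mspace X"
      then obtain i U where i: "i \<le> n" "U \<in> \<U> i" "x \<in> U"
        using A \<U>(1) by blast
      then have "x \<in> (\<Union>j\<le>m. \<Union>(\<V> U j))"
        using \<V>(1) by blast
      then obtain j where j: "j \<le> m" "x \<in> \<Union>(\<V> U j)"
        by blast
      define k where "k = i * Suc m + j"
      have "i * Suc m \<le> n * Suc m"
        using i by (intro mult_right_mono) auto
      then have "k \<le> Suc n * Suc m - 1"
        using j by (simp add: k_def)
      moreover have "k div Suc m = i" "k mod Suc m = j"
        using j by (simp_all add: k_def del: mult_Suc_right)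
      then have "x \<in> \<Union>(\<W> k)"
        using i j unfolding \<W>_def by blast
      ultimately show "x \<in> (\<Union>k\<le>Suc n * Suc m - 1. \<Union>(\<W> k))"
        by blast
    qed
    show "(\<Union>k\<le>Suc n * Suc m - 1. \<Union>(\<W> k)) \<subseteq> mspace X"
    proof clarify
      fix x k V assume k: "k \<le> Suc n * Suc m - 1" and "V \<in> \<W> k" "x \<in> V"
      then obtain U where U: "U \<in> \<U> (k div Suc m)" "x \<in> \<Union>(\<V> U (k mod Suc m))"
        unfolding \<W>_def by blast
      then have "x \<in> U"
        using \<V>(1)[of U] div[OF k] mod by blast
      then show "x \<in> mspace X"
        using sub[OF div[OF k] U(1)] by blast
    qed
  qed
  ultimately show "\<exists>A. mspace X = (\<Union>k\<le>Suc n * Suc m - 1. A k) \<and>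
      (\<forall>k\<le>Suc n * Suc m - 1. r_disjoint_union_in X r \<Z> (A k))"
    by blast
qed

lemma decomposable_over_refl: "decomposable_over r 0 \<X> \<X>"
  unfolding decomposable_over_def r_disjoint_union_in_def
proof
  fix X assume "X \<in> \<X>"
  then show "\<exists>A. mspace X = (\<Union>i\<le>0. A i) \<and> (\<forall>i\<le>0::nat. \<exists>\<U>. A i = \<Union>\<U> \<and> r_disjoint X r \<U> \<and>
      (\<forall>U\<in>\<U>. submetric X U \<in> \<X>))"
    by (intro exI[of _ "\<lambda>_. mspace X"] conjI allI impI exI[of _ "{mspace X}"])
      (auto simp: r_disjoint_def)
qed

text \<open>The scale is fixed before the collection is formed, while the number of colours may vary with
  the family: this is what makes the collection closed, since weak decomposability over it
  gives, at the scale \<open>r\<close>, one intermediate family with its own number of colours.\<close>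

lemma wD_decomposable_over_bounded:
  assumes "\<X> \<in> wD" "r > 0"
  shows "\<exists>n. \<exists>\<Y>\<in>bounded_families. decomposable_over r n \<X> \<Y>"
proof -
  define \<CC> :: "'a metric set set" where
    "\<CC> = {\<X>. metric_family \<X> \<and> (\<exists>n. \<exists>\<Y>\<in>bounded_families. decomposable_over r n \<X> \<Y>)}"
  have "wD \<subseteq> \<CC>"
  proof (rule wD_least)
    show "\<CC> \<subseteq> Collect metric_family"
      by (auto simp: \<CC>_def)
    show "bounded_families \<subseteq> \<CC>"
      using decomposable_over_refl bounded_families_subset_wD wD_metric_family
      unfolding \<CC>_def by blast
    show "closed_under_weak_decomposition \<CC>"
      unfolding closed_under_weak_decomposition_def
    proof clarify
      fix \<X> :: "'a metric set"
      assume \<X>: "metric_family \<X>" "weakly_decomposable_over \<X> \<CC>"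
      then obtain n \<Y> where "\<Y> \<in> \<CC>" "decomposable_over r n \<X> \<Y>"
        using \<open>r > 0\<close> unfolding weakly_decomposable_over_def n_decomposable_over_def by blast
      then show "\<X> \<in> \<CC>"
        using \<X>(1) decomposable_over_trans unfolding \<CC>_def by blast
    qed
  qed
  with assms(1) show ?thesis
    unfolding \<CC>_def by blast
qed

section \<open>Rescaling covers by an expansion\<close>

lemma uniform_expansion_funpow:
  assumes "uniform_expansion X c T"
  shows "uniform_expansion X (c ^ k) (T ^^ k)"
proof (induction k)
  case 0
  then show ?case by (simp add: uniform_expansion_def)
next
  case (Suc k)
  with assms show ?case
    by (simp add: uniform_expansion_def Pi_iff mult.assoc)
qed

lemma funpow_image_eq: "T ` S = S \<Longrightarrow> (T ^^ k) ` S = S"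
  by (induction k) (simp, metis funpow.simps(2) image_comp)

lemma r_disjoint_expansion_image:
  assumes T: "uniform_expansion X c T" and dis: "r_disjoint X s \<U>"
    and sub: "\<Union>\<U> \<subseteq> mspace X" and "s > 0" "c > 0" "0 \<le> r" "r < c * s"
  shows "r_disjoint X r ((`) T ` \<U>)"
  unfolding r_disjoint_def
proof clarify
  fix U V assume UV: "U \<in> \<U>" "V \<in> \<U>" "T ` U \<noteq> T ` V"
  have "ennreal (c * s) \<le> mset_dist X (T ` U) (T ` V)"
    unfolding mset_dist_def
  proof (rule INF_greatest, rule INF_greatest, clarify)
    fix x y assume xy: "x \<in> U" "y \<in> V"
    have "ennreal s < mset_dist X U V"
      using dis UV unfolding r_disjoint_def by blast
    also have "\<dots> \<le> ennreal (mdist X x y)"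
      using xy by (rule mset_dist_le)
    finally have "s \<le> mdist X x y"
      using \<open>s > 0\<close> by (simp add: ennreal_less_iff)
    moreover have "mdist X (T x) (T y) = c * mdist X x y"
      using T sub UV xy unfolding uniform_expansion_def by blast
    ultimately show "ennreal (c * s) \<le> ennreal (mdist X (T x) (T y))"
      using \<open>c > 0\<close> by (simp add: ennreal_leI)
  qed
  moreover have "ennreal r < ennreal (c * s)"
    using assms by (simp add: ennreal_lessI)
  ultimately show "ennreal r < mset_dist X (T ` U) (T ` V)"
    by order
qed

lemma mdiam_expansion_image_le:
  assumes T: "uniform_expansion X c T" and "U \<subseteq> mspace X" "c > 0"
  shows "mdiam X (T ` U) \<le> ennreal c * mdiam X U"
  unfolding mdiam_def[of X "T ` U"]
proof (rule SUP_least, rule SUP_least, clarify)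
  fix x y assume xy: "x \<in> U" "y \<in> U"
  then have "mdist X (T x) (T y) = c * mdist X x y"
    using T assms(2) unfolding uniform_expansion_def by blast
  then show "ennreal (mdist X (T x) (T y)) \<le> ennreal c * mdiam X U"
    using xy \<open>c > 0\<close> by (auto simp: ennreal_mult intro!: mult_left_mono le_mdiam)
qed

text \<open>One decomposition, at scale 1, determines the bound on the asymptotic dimension.  Surjectivity
  makes the images of its pieces cover the space again.\<close>

lemma asdim_le_if_expansion:
  assumes c: "c > 1" and T: "uniform_expansion X c T" and surj: "T ` mspace X = mspace X"
    and \<Y>: "\<Y> \<in> bounded_families" and dec: "decomposable_over 1 n {X} \<Y>"
  shows "asdim_le X n"
  unfolding asdim_le_def
proof (intro allI impI)
  fix r :: real assume r: "r > 0"
  obtain A where A: "mspace X = (\<Union>i\<le>n. A i)"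
    and "\<forall>i\<le>n. r_disjoint_union_in X 1 \<Y> (A i)"
    using dec unfolding decomposable_over_def by blast
  then obtain \<U> where \<U>: "\<And>i. i \<le> n \<Longrightarrow> A i = \<Union>(\<U> i)"
      "\<And>i. i \<le> n \<Longrightarrow> r_disjoint X 1 (\<U> i)"
      "\<And>i U. i \<le> n \<Longrightarrow> U \<in> \<U> i \<Longrightarrow> submetric X U \<in> \<Y>"
    unfolding r_disjoint_union_in_def by metis
  have cover: "mspace X = (\<Union>i\<le>n. \<Union>(\<U> i))"
    using A \<U>(1) by simp
  have sub: "\<Union>(\<U> i) \<subseteq> mspace X" if "i \<le> n" for i
    using that cover by blast
  define D where "D = (SUP Z\<in>\<Y>. mdiam Z (mspace Z))"
  have D: "D < \<infinity>"
    using \<Y> by (simp add: bounded_families_def D_def)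
  have diam: "mdiam X U \<le> D" if "i \<le> n" "U \<in> \<U> i" for i U
  proof -
    have "mspace (submetric X U) = U"
      using sub that by auto
    then show ?thesis
      unfolding D_def using SUP_upper[OF \<U>(3)[OF that], of "\<lambda>Z. mdiam Z (mspace Z)"]
      by (metis mdiam_submetric)
  qed
  obtain k where k: "r < c ^ k"
    using real_arch_pow[OF c] by blast
  have Tk: "uniform_expansion X (c ^ k) (T ^^ k)"
    using T by (rule uniform_expansion_funpow)
  have ck: "c ^ k > 0" using c by simp
  define \<V> where "\<V> i = (`) (T ^^ k) ` \<U> i" for i
  have "(\<Union>i\<le>n. \<Union>(\<V> i)) = (T ^^ k) ` (\<Union>i\<le>n. \<Union>(\<U> i))"
    by (auto simp: \<V>_def)
  also have "\<dots> = mspace X"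
    unfolding cover[symmetric] using surj by (rule funpow_image_eq)
  finally have "(\<Union>i\<le>n. \<Union>(\<V> i)) = mspace X" .
  moreover have "\<forall>i\<le>n. r_disjoint X r (\<V> i)"
    unfolding \<V>_def using r_disjoint_expansion_image[OF Tk \<U>(2) sub] r k ck by simp
  moreover have "(SUP U\<in>(\<Union>i\<le>n. \<V> i). mdiam X U) \<le> ennreal (c ^ k) * D"
  proof (rule SUP_least)
    fix V assume "V \<in> (\<Union>i\<le>n. \<V> i)"
    then obtain i U where i: "i \<le> n" "U \<in> \<U> i" and V: "V = (T ^^ k) ` U"
      unfolding \<V>_def by blast
    then have "mdiam X V \<le> ennreal (c ^ k) * mdiam X U"
      using mdiam_expansion_image_le[OF Tk _ ck] sub by blast
    also have "\<dots> \<le> ennreal (c ^ k) * D"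
      using diam[OF i] by (rule mult_left_mono) simp
    finally show "mdiam X V \<le> ennreal (c ^ k) * D" .
  qed
  moreover have "ennreal (c ^ k) * D < \<infinity>"
    using D by (simp add: ennreal_mult_less_top)
  ultimately show "\<exists>\<U>. (\<Union>i\<le>n. \<Union>(\<U> i)) = mspace X \<and> (\<forall>i\<le>n. r_disjoint X r (\<U> i)) \<and>
      (SUP U\<in>(\<Union>i\<le>n. \<U> i). mdiam X U) < \<infinity>"
    by (meson le_less_trans)
qed

theorem theorem2p16:
  fixes X :: "'a metric"
  assumes "\<exists>c>1. \<exists>T. uniform_expansion X c T \<and> T ` mspace X = mspace X"
    and "weak_fdc {X}"
  shows "finite_asdim X"
proof -
  obtain c T where "c > 1" "uniform_expansion X c T" "T ` mspace X = mspace X"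
    using assms(1) by blast
  moreover obtain n \<Y> where "\<Y> \<in> bounded_families" "decomposable_over 1 n {X} \<Y>"
    using assms(2) wD_decomposable_over_bounded[of "{X}" 1] unfolding weak_fdc_def by auto
  ultimately show ?thesis
    unfolding finite_asdim_def using asdim_le_if_expansion by blast
qed

end
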